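(* Let $W$ be a positive random variable with $\mathbf{E}[W^2]<\mathbf{E}[W]$ and let $a>0$. Let $\mathcal{C}_n$ be the cycle-counting point process of the generalised random graph on $n$ vertices with weight distribution that of $W$. There exists a constant $C>0$ such that for all $n\geq 3$, $$\mathbf{P}\big(\mathcal{C}_n(\{\lfloor a\log(n)\rfloor+1,\dots,n\})>0\big)\leq C n^{a\log(p)}\quad\text{for}\quad p=\frac{2\mathbf{E}[W^2]}{\mathbf{E}[W^2]+\mathbf{E}[W]}.$$
   Context: Generalised random graph: for $n\in\mathbb{N}$ the vertex set is $[n]=\{1,\dots,n\}$, the vertices carry i.i.d. weights $W_1,\dots,W_n$ distributed as the positive random variable $W$, and $L_n=\sum_{i=1}^n W_i$. Conditionally on the weights, any two distinct vertices $i,j\in[n]$ are joined by an edge independently with probability $\frac{W_iW_j}{W_iW_j+L_n}$. For a set $A$ of positive integers, $\mathcal{C}_n(A)$ is the number of cycles (as subgraphs, each counted once irrespective of starting vertex and orientation) in the graph whose length lies in $A$; all cycles have length at least $3$. $\lfloor\cdot\rfloor$ is the floor function. *)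

theory Defs
  imports "HOL-Probability.Probability"
begin

text \<open>A simple graph on the vertex set \<open>{1..n}\<close> is represented by its set of edges,
  an edge being a two-element set of vertices.\<close>

definition pairs :: "nat \<Rightarrow> nat set set" where
  "pairs n = {e. e \<subseteq> {1..n} \<and> card e = 2}"

text \<open>For \<open>e = {i, j}\<close> with \<open>i \<noteq> j\<close>, the product over \<open>e\<close> is \<open>w i * w j\<close>, and the sum is \<open>L\<^sub>n\<close>.\<close>

definition edge_prob :: "nat \<Rightarrow> (nat \<Rightarrow> real) \<Rightarrow> nat set \<Rightarrow> real" where
  "edge_prob n w e = (\<Prod>i\<in>e. w i) / ((\<Prod>i\<in>e. w i) + (\<Sum>i\<in>{1..n}. w i))"

text \<open>Conditional law of the graph given the weights: each pair is present independently.
  The parameter lies in \<open>[0, 1]\<close> whenever the weights are positive; otherwise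
  \<^const>\<open>bernoulli_pmf\<close> truncates it, which only matters on a null set.\<close>

definition grg_given :: "nat \<Rightarrow> (nat \<Rightarrow> real) \<Rightarrow> nat set set pmf" where
  "grg_given n w =
     map_pmf (\<lambda>f. {e \<in> pairs n. f e})
       (Pi_pmf (pairs n) False (\<lambda>e. bernoulli_pmf (edge_prob n w e)))"

text \<open>Law of the generalised random graph on \<open>n\<close> vertices, where \<open>D\<close> is the law of a single weight.\<close>

definition grg :: "nat \<Rightarrow> real measure \<Rightarrow> nat set set measure" where
  "grg n D = (\<Pi>\<^sub>M i\<in>{1..n}. D) \<bind> (\<lambda>w. measure_pmf (grg_given n w))"

definition cycle_edges :: "'a list \<Rightarrow> 'a set set" where
  "cycle_edges vs = {{vs ! i, vs ! (Suc i mod length vs)} |i. i < length vs}"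

text \<open>A cycle subgraph is identified with its edge set, so that each cycle occurs only once,
  whatever starting vertex and orientation is used to list its vertices.\<close>

definition cycles :: "'a set set \<Rightarrow> nat set \<Rightarrow> 'a set set set" where
  "cycles G A =
     {cycle_edges vs |vs. distinct vs \<and> 3 \<le> length vs \<and> length vs \<in> A \<and> cycle_edges vs \<subseteq> G}"

definition cycle_count :: "'a set set \<Rightarrow> nat set \<Rightarrow> nat" where
  "cycle_count G A = card (cycles G A)"

text \<open>The use of \<^const>\<open>bind\<close> above requires the conditional law to depend measurably on the
  weights.\<close>

lemma finite_pairs: "finite (pairs n)"
  by (rule finite_subset[of _ "Pow {1..n}"]) (auto simp: pairs_def)

lemma finite_cycles:
  assumes "finite G"
  shows "finite (cycles G A)"
  by (rule finite_subset[of _ "Pow G"]) (auto simp: cycles_def assms)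

lemma set_pmf_grg_given: "set_pmf (grg_given n w) \<subseteq> Pow (pairs n)"
  by (auto simp: grg_given_def)

lemma pmf_grg_given:
  assumes "G \<subseteq> pairs n"
  shows "pmf (grg_given n w) G = (\<Prod>e\<in>pairs n. pmf (bernoulli_pmf (edge_prob n w e)) (e \<in> G))"
proof -
  let ?P = "Pi_pmf (pairs n) False (\<lambda>e. bernoulli_pmf (edge_prob n w e))"
  have "pmf (grg_given n w) G = measure_pmf.prob ?P ((\<lambda>f. {e \<in> pairs n. f e}) -` {G})"
    by (simp add: grg_given_def pmf_map)
  also have "\<dots> = measure_pmf.prob ?P {\<lambda>e. e \<in> G}"
  proof (rule measure_eq_AE)
    show "AE f in measure_pmf ?P. f \<in> (\<lambda>f. {e \<in> pairs n. f e}) -` {G} \<longleftrightarrow> f \<in> {\<lambda>e. e \<in> G}"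
    proof (rule AE_pmfI)
      fix f assume "f \<in> set_pmf ?P"
      with set_Pi_pmf_subset[OF finite_pairs] have "\<forall>e. e \<notin> pairs n \<longrightarrow> \<not> f e"
        by fastforce
      then show "f \<in> (\<lambda>f. {e \<in> pairs n. f e}) -` {G} \<longleftrightarrow> f \<in> {\<lambda>e. e \<in> G}"
        using assms by (auto simp: fun_eq_iff)
    qed
  qed auto
  also have "\<dots> = pmf ?P (\<lambda>e. e \<in> G)"
    by (simp add: measure_pmf_single)
  also have "\<dots> = (\<Prod>e\<in>pairs n. pmf (bernoulli_pmf (edge_prob n w e)) (e \<in> G))"
    using assms by (intro pmf_Pi') (auto simp: finite_pairs)
  finally show ?thesis .
qed

lemma pmf_bernoulli_truncate:
  "pmf (bernoulli_pmf p) b = (if b then min 1 (max 0 p) else 1 - min 1 (max 0 p))"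
  by (simp add: bernoulli_pmf.rep_eq)

lemma measurable_grg_given:
  assumes D: "sets D = sets (borel :: real measure)"
  shows "(\<lambda>w. measure_pmf (grg_given n w))
           \<in> measurable (\<Pi>\<^sub>M i\<in>{1..n}. D) (subprob_algebra (count_space UNIV))"
proof (rule measurable_subprob_algebra)
  let ?P = "\<Pi>\<^sub>M i\<in>{1..n}. D"
  have comp: "(\<lambda>w. w i) \<in> borel_measurable ?P" if "i \<in> {1..n}" for i
    using measurable_component_singleton[OF that, of "\<lambda>_. D"] measurable_cong_sets[OF refl D]
    by auto
  have edge: "(\<lambda>w. edge_prob n w e) \<in> borel_measurable ?P" if "e \<in> pairs n" for e
    using that comp unfolding edge_prob_def pairs_def
    by (intro borel_measurable_divide borel_measurable_add borel_measurable_prod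
          borel_measurable_sum) auto
  have pmf: "(\<lambda>w. pmf (grg_given n w) G) \<in> borel_measurable ?P" if "G \<in> Pow (pairs n)" for G
  proof -
    have "(\<lambda>w. pmf (bernoulli_pmf (edge_prob n w e)) (e \<in> G)) \<in> borel_measurable ?P"
      if e: "e \<in> pairs n" for e
      using edge[OF e] unfolding pmf_bernoulli_truncate by (cases "e \<in> G") simp_all
    then show ?thesis
      using that by (simp add: pmf_grg_given)
  qed
  fix S :: "nat set set set"
  have "emeasure (measure_pmf (grg_given n w)) S
      = ennreal (\<Sum>G\<in>S \<inter> Pow (pairs n). pmf (grg_given n w) G)" for w
  proof -
    have "measure_pmf.prob (grg_given n w) S
        = measure_pmf.prob (grg_given n w) (S \<inter> Pow (pairs n))"
      using set_pmf_grg_given[of n w] by (intro measure_eq_AE AE_pmfI) auto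
    also have "\<dots> = (\<Sum>G\<in>S \<inter> Pow (pairs n). pmf (grg_given n w) G)"
      by (intro measure_measure_pmf_finite) (simp add: finite_pairs)
    finally show ?thesis
      by (simp add: measure_pmf.emeasure_eq_measure)
  qed
  then show "(\<lambda>w. emeasure (measure_pmf (grg_given n w)) S) \<in> borel_measurable ?P"
    using pmf by simp
qed (auto intro: measure_pmf.subprob_space_axioms)

lemma prob_grg:
  assumes "prob_space D" and "sets D = sets borel"
  shows "measure (grg n D) S
       = (\<integral>w. measure_pmf.prob (grg_given n w) S \<partial>(\<Pi>\<^sub>M i\<in>{1..n}. D))"
proof -
  interpret D: prob_space D by fact
  interpret P: prob_space "\<Pi>\<^sub>M i\<in>{1..n}. D" by (rule prob_space_PiM) (rule D.prob_space_axioms)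
  show ?thesis
    unfolding grg_def
    by (rule P.measure_bind[OF measurable_grg_given[OF assms(2)]]) simp
qed

end

theory Submission
  imports Defs
begin

text \<open>The proof is a first moment bound on the number of long cycles, made possible by an
  exponential estimate for the lower tail of the total weight \<open>L\<^sub>n\<close>.

  Given positive weights \<open>w\<close>, a pair \<open>{i, j}\<close> is an edge with probability at most
  \<open>w i * w j / L\<^sub>n\<close>. Along a cycle each vertex lies on exactly two edges, so the cycle through
  \<open>v\<^sub>1, \<dots>, v\<^sub>k\<close> is present with probability at most \<open>(\<Prod>i. (w v\<^sub>i)\<^sup>2) / L\<^sub>n ^ k\<close>
  (lemma \<open>prob_cycle_le\<close>).
  If \<open>L\<^sub>n\<close> could be replaced by \<open>n * t\<close>, integrating over the weights and summing over the at most
  \<open>n ^ k\<close> vertex sequences would give at most \<open>(E[W\<^sup>2] / t) ^ k\<close> expected cycles of length \<open>k\<close>.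

  The choice \<open>t = E[W]\<close> would fail because \<open>L\<^sub>n\<close> fluctuates around \<open>n * E[W]\<close>, but the midpoint
  \<open>t = (E[W] + E[W\<^sup>2]) / 2\<close> of the gap leaves room on both sides. On the one hand
  \<open>E[W\<^sup>2] / t = p < 1\<close>, so the lengths \<open>k > a ln n\<close> contribute a geometric series of order
  \<open>p powr (a ln n) = n powr (a ln p)\<close>. On the other hand \<open>t < E[W]\<close>; as the weights are nonnegative
  with finite second moment, the event \<open>L\<^sub>n < n * t\<close> has probability at most \<open>exp (- c * n)\<close> for
  some \<open>c > 0\<close> by Chernoff's method (lemma \<open>laplace_transform_le\<close>), and this decays faster than
  any power of \<open>n\<close>. The two contributions are combined in lemma \<open>grg_cycle_bound\<close>.\<close>

section \<open>Cycles given by vertex sequences\<close>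

definition cyclic_sequences :: "nat \<Rightarrow> nat set \<Rightarrow> nat list set" where
  "cyclic_sequences n A =
     {vs. distinct vs \<and> 3 \<le> length vs \<and> length vs \<in> A \<and> set vs \<subseteq> {1..n}}"

lemma cyclic_sequences_length_le:
  assumes "vs \<in> cyclic_sequences n A"
  shows "length vs \<le> n"
proof -
  have "card (set vs) \<le> card {1..n}"
    using assms by (intro card_mono) (auto simp: cyclic_sequences_def)
  then show ?thesis
    using assms by (simp add: cyclic_sequences_def distinct_card)
qed

lemma finite_cyclic_sequences: "finite (cyclic_sequences n A)"
proof (rule finite_subset)
  show "cyclic_sequences n A \<subseteq> {vs. set vs \<subseteq> {1..n} \<and> length vs \<le> n}"
    using cyclic_sequences_length_le by (auto simp: cyclic_sequences_def)
qed (rule finite_lists_length_le, simp)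

lemma cycle_edges_altdef:
  "cycle_edges vs = (\<lambda>i. {vs ! i, vs ! (Suc i mod length vs)}) ` {..<length vs}"
  by (auto simp: cycle_edges_def)

lemma mod_Suc_less:
  assumes "i < k"
  shows "Suc i mod k = (if Suc i = k then 0 else Suc i)"
  using assms by auto

text \<open>Length at least 3 is essential: in a closed sequence of length 2 both steps traverse the same
  pair of vertices.\<close>

lemma inj_on_cycle_edge:
  assumes "distinct vs" "3 \<le> length vs"
  shows "inj_on (\<lambda>i. {vs ! i, vs ! (Suc i mod length vs)}) {..<length vs}"
proof (rule inj_onI)
  fix i j
  assume i: "i \<in> {..<length vs}" and j: "j \<in> {..<length vs}"
    and eq: "{vs ! i, vs ! (Suc i mod length vs)} = {vs ! j, vs ! (Suc j mod length vs)}"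
  have lt: "Suc i mod length vs < length vs" "Suc j mod length vs < length vs"
    using assms by (auto intro!: mod_less_divisor)
  have "i = j \<or> (i = Suc j mod length vs \<and> Suc i mod length vs = j)"
    using eq i j lt assms(1) by (auto simp: doubleton_eq_iff nth_eq_iff_index_eq)
  then show "i = j"
    using i j assms(2) by (auto simp: mod_Suc_less split: if_splits)
qed

lemma cycle_edge_neq:
  assumes "distinct vs" "3 \<le> length vs" "i < length vs"
  shows "vs ! i \<noteq> vs ! (Suc i mod length vs)"
proof -
  have "Suc i mod length vs < length vs"
    using assms by (intro mod_less_divisor) auto
  then show ?thesis
    using assms by (auto simp: nth_eq_iff_index_eq mod_Suc_less split: if_splits)
qed

lemma cycle_edges_subset_pairs:
  assumes "vs \<in> cyclic_sequences n A"
  shows "cycle_edges vs \<subseteq> pairs n"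
proof
  fix e assume "e \<in> cycle_edges vs"
  then obtain i where i: "i < length vs" and e: "e = {vs ! i, vs ! (Suc i mod length vs)}"
    by (auto simp: cycle_edges_def)
  have "Suc i mod length vs < length vs"
    using i by (intro mod_less_divisor) auto
  then have "e \<subseteq> set vs"
    using i e by auto
  moreover have "card e = 2"
    using assms cycle_edge_neq[of vs i] i e by (simp add: cyclic_sequences_def)
  ultimately show "e \<in> pairs n"
    using assms by (auto simp: pairs_def cyclic_sequences_def)
qed

lemma cyclic_sequence_exists:
  assumes "G \<subseteq> pairs n" "cycle_count G A > 0"
  shows "\<exists>vs\<in>cyclic_sequences n A. cycle_edges vs \<subseteq> G"
proof -
  have "cycles G A \<noteq> {}"
    using assms(2) by (auto simp: cycle_count_def card_gt_0_iff)
  then obtain vs where vs: "distinct vs" "3 \<le> length vs" "length vs \<in> A" "cycle_edges vs \<subseteq> G"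
    by (auto simp: cycles_def)
  have "vs ! i \<in> {1..n}" if "i < length vs" for i
  proof -
    have "{vs ! i, vs ! (Suc i mod length vs)} \<in> pairs n"
      using that vs(4) assms(1) by (auto simp: cycle_edges_def)
    then show ?thesis
      by (auto simp: pairs_def)
  qed
  then have "set vs \<subseteq> {1..n}"
    by (auto simp: in_set_conv_nth)
  with vs show ?thesis
    by (auto simp: cyclic_sequences_def)
qed

text \<open>Every vertex of a cycle lies on exactly two of its edges.\<close>

lemma prod_cycle_edges:
  fixes w :: "'b \<Rightarrow> real"
  assumes "distinct vs" "3 \<le> length vs"
  shows "(\<Prod>e\<in>cycle_edges vs. \<Prod>i\<in>e. w i) = (\<Prod>v\<in>set vs. (w v)\<^sup>2)"
proof -
  define k where "k = length vs"
  obtain m where m: "k = Suc m"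
    using assms(2) by (cases k) (auto simp: k_def)
  have "(\<Prod>e\<in>cycle_edges vs. \<Prod>i\<in>e. w i)
      = (\<Prod>i<k. \<Prod>v\<in>{vs ! i, vs ! (Suc i mod k)}. w v)"
    unfolding cycle_edges_altdef k_def
    by (subst prod.reindex[OF inj_on_cycle_edge[OF assms]]) simp
  also have "\<dots> = (\<Prod>i<k. w (vs ! i) * w (vs ! (Suc i mod k)))"
    using cycle_edge_neq[OF assms] by (intro prod.cong) (auto simp: k_def)
  also have "\<dots> = (\<Prod>i<k. w (vs ! i)) * (\<Prod>i<k. w (vs ! (Suc i mod k)))"
    by (rule prod.distrib)
  also have "(\<Prod>i<k. w (vs ! (Suc i mod k))) = (\<Prod>i<m. w (vs ! Suc i)) * w (vs ! 0)"
    unfolding m by simp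
  also have "\<dots> = (\<Prod>i<k. w (vs ! i))"
    unfolding m prod.lessThan_Suc_shift by simp
  also have "(\<Prod>i<k. w (vs ! i)) = (\<Prod>v\<in>set vs. w v)"
    using assms(1) by (intro prod.reindex_bij_betw bij_betw_nth) (auto simp: k_def)
  finally show ?thesis
    by (simp add: power2_eq_square prod.distrib)
qed

section \<open>Cycles in the graph with given weights\<close>

lemma prob_edges_present:
  assumes E: "E \<subseteq> pairs n" and "\<And>e. e \<in> E \<Longrightarrow> edge_prob n w e \<in> {0..1}"
  shows "measure_pmf.prob (grg_given n w) {G. E \<subseteq> G} = (\<Prod>e\<in>E. edge_prob n w e)"
proof -
  let ?P = "Pi_pmf (pairs n) False (\<lambda>e. bernoulli_pmf (edge_prob n w e))"
  let ?B = "\<lambda>e. if e \<in> E then {True} else UNIV"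
  have "(\<lambda>f. {e \<in> pairs n. f e}) -` {G. E \<subseteq> G} = Pi (pairs n) ?B"
    using E by (auto simp: Pi_def)
  then have "measure_pmf.prob (grg_given n w) {G. E \<subseteq> G} = measure_pmf.prob ?P (Pi (pairs n) ?B)"
    by (simp add: grg_given_def)
  also have "\<dots> = (\<Prod>e\<in>pairs n. measure_pmf.prob (bernoulli_pmf (edge_prob n w e)) (?B e))"
    by (rule measure_Pi_pmf_Pi[OF finite_pairs])
  also have "\<dots> = (\<Prod>e\<in>E. measure_pmf.prob (bernoulli_pmf (edge_prob n w e)) {True})"
    using E by (intro prod.mono_neutral_cong_right finite_pairs) auto
  also have "\<dots> = (\<Prod>e\<in>E. edge_prob n w e)"
    using assms(2) by (intro prod.cong) (auto simp: measure_pmf_single)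
  finally show ?thesis .
qed

lemma edge_prob_bounds:
  assumes pos: "\<And>i. i \<in> {1..n} \<Longrightarrow> w i > 0" and e: "e \<in> pairs n"
  shows "0 \<le> edge_prob n w e" "edge_prob n w e \<le> 1"
    and "edge_prob n w e \<le> (\<Prod>i\<in>e. w i) / (\<Sum>i\<in>{1..n}. w i)"
proof -
  have sub: "e \<subseteq> {1..n}" and "e \<noteq> {}"
    using e by (auto simp: pairs_def)
  have x: "(\<Prod>i\<in>e. w i) > 0"
    using pos sub by (intro prod_pos) auto
  have L: "(\<Sum>i\<in>{1..n}. w i) > 0"
    using pos sub \<open>e \<noteq> {}\<close> by (intro sum_pos) auto
  show "0 \<le> edge_prob n w e" "edge_prob n w e \<le> 1"
    using x L by (auto simp: edge_prob_def)
  show "edge_prob n w e \<le> (\<Prod>i\<in>e. w i) / (\<Sum>i\<in>{1..n}. w i)"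
    unfolding edge_prob_def using x L by (intro divide_left_mono) auto
qed

lemma prob_cycle_le:
  assumes pos: "\<And>i. i \<in> {1..n} \<Longrightarrow> w i > 0" and vs: "vs \<in> cyclic_sequences n A"
  shows "measure_pmf.prob (grg_given n w) {G. cycle_edges vs \<subseteq> G}
       \<le> (\<Prod>v\<in>set vs. (w v)\<^sup>2) / (\<Sum>i\<in>{1..n}. w i) ^ length vs"
proof -
  note E = cycle_edges_subset_pairs[OF vs]
  have d: "distinct vs" "3 \<le> length vs"
    using vs by (auto simp: cyclic_sequences_def)
  have card: "card (cycle_edges vs) = length vs"
    unfolding cycle_edges_altdef using card_image[OF inj_on_cycle_edge[OF d]] by simp
  have "measure_pmf.prob (grg_given n w) {G. cycle_edges vs \<subseteq> G}
      = (\<Prod>e\<in>cycle_edges vs. edge_prob n w e)"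
    using E by (intro prob_edges_present) (auto intro!: edge_prob_bounds pos)
  also have "\<dots> \<le> (\<Prod>e\<in>cycle_edges vs. (\<Prod>i\<in>e. w i) / (\<Sum>i\<in>{1..n}. w i))"
    using E by (intro prod_mono conjI edge_prob_bounds pos) auto
  also have "\<dots> = (\<Prod>v\<in>set vs. (w v)\<^sup>2) / (\<Sum>i\<in>{1..n}. w i) ^ length vs"
    by (simp add: prod_dividef prod_cycle_edges[OF d] card)
  finally show ?thesis .
qed

text \<open>The summand \<open>exp (s * (n * t - L\<^sub>n))\<close> is at least 1 when \<open>L\<^sub>n < n * t\<close>, and otherwise
  \<open>L\<^sub>n\<close> may be replaced by \<open>n * t\<close> in the union bound. Using it in place of the indicator of
  \<open>L\<^sub>n < n * t\<close> builds Chernoff's inequality into the estimate, and both summands then integrate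
  to products over the independent weights.\<close>

lemma prob_cycle_count_le:
  assumes pos: "\<And>i. i \<in> {1..n} \<Longrightarrow> w i > 0" and n: "n \<ge> 1" and t: "t > 0" and s: "s \<ge> 0"
  shows "measure_pmf.prob (grg_given n w) {G. cycle_count G A > 0}
       \<le> exp (s * (real n * t)) * (\<Prod>i\<in>{1..n}. exp (- s * w i))
         + (\<Sum>vs\<in>cyclic_sequences n A. (\<Prod>v\<in>set vs. (w v)\<^sup>2) / (real n * t) ^ length vs)"
    (is "?p \<le> ?X + ?Y")
proof -
  define L where "L = (\<Sum>i\<in>{1..n}. w i)"
  have X: "?X = exp (s * (real n * t - L))"
    by (simp add: L_def exp_sum[symmetric] exp_add[symmetric] sum_distrib_left sum_negf
        right_diff_distrib)
  have Y0: "0 \<le> ?Y"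
    using t by (intro sum_nonneg divide_nonneg_nonneg prod_nonneg) auto
  show ?thesis
  proof (cases "L < real n * t")
    case True
    then have "1 \<le> ?X"
      unfolding X using s by simp
    moreover have "?p \<le> 1"
      by simp
    ultimately show ?thesis
      using Y0 by linarith
  next
    case False
    let ?S = "cyclic_sequences n A"
    have L_pos: "L > 0"
      unfolding L_def using pos n by (intro sum_pos) auto
    have "?p \<le> measure_pmf.prob (grg_given n w) (\<Union>vs\<in>?S. {G. cycle_edges vs \<subseteq> G})"
    proof (intro measure_pmf.finite_measure_mono_AE AE_pmfI impI)
      fix G assume "G \<in> set_pmf (grg_given n w)" "G \<in> {G. cycle_count G A > 0}"
      then have "\<exists>vs\<in>?S. cycle_edges vs \<subseteq> G"
        using set_pmf_grg_given[of n w] by (intro cyclic_sequence_exists) auto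
      then show "G \<in> (\<Union>vs\<in>?S. {G. cycle_edges vs \<subseteq> G})"
        by blast
    qed simp
    also have "\<dots> \<le> (\<Sum>vs\<in>?S. measure_pmf.prob (grg_given n w) {G. cycle_edges vs \<subseteq> G})"
      by (intro measure_UNION_le finite_cyclic_sequences) auto
    also have "\<dots> \<le> ?Y"
    proof (rule sum_mono)
      fix vs assume "vs \<in> ?S"
      then have "measure_pmf.prob (grg_given n w) {G. cycle_edges vs \<subseteq> G}
          \<le> (\<Prod>v\<in>set vs. (w v)\<^sup>2) / L ^ length vs"
        unfolding L_def by (intro prob_cycle_le pos)
      also have "\<dots> \<le> (\<Prod>v\<in>set vs. (w v)\<^sup>2) / (real n * t) ^ length vs"
        using L_pos False n t
        by (intro divide_left_mono power_mono prod_nonneg mult_pos_pos zero_less_power) auto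
      finally show "measure_pmf.prob (grg_given n w) {G. cycle_edges vs \<subseteq> G}
          \<le> (\<Prod>v\<in>set vs. (w v)\<^sup>2) / (real n * t) ^ length vs" .
    qed
    finally show ?thesis
      using exp_ge_zero[of "s * (real n * t - L)"] unfolding X by linarith
  qed
qed

section \<open>Averaging over the weights\<close>

lemma exp_minus_le_quadratic:
  fixes x :: real
  assumes "0 \<le> x"
  shows "exp (- x) \<le> 1 - x + x\<^sup>2 / 2"
proof -
  let ?f = "\<lambda>x::real. 1 - x + x\<^sup>2 / 2 - exp (- x)"
  have "?f 0 \<le> ?f x"
  proof (rule DERIV_nonneg_imp_nondecreasing[OF assms])
    fix y :: real
    have "(?f has_real_derivative (- 1 + y + exp (- y))) (at y)"
      by (auto intro!: derivative_eq_intros)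
    moreover have "0 \<le> - 1 + y + exp (- y)"
      using exp_ge_add_one_self[of "- y"] by simp
    ultimately show "\<exists>d. (?f has_real_derivative d) (at y) \<and> 0 \<le> d"
      by blast
  qed
  then show ?thesis
    by simp
qed

text \<open>On the nonnegative half-line \<open>exp (- s * x)\<close> lies below its second Taylor polynomial, so two
  moments control the whole transform. This is why the lower tail of \<open>L\<^sub>n\<close> is exponentially small
  although the upper tail need not be.\<close>

lemma laplace_transform_le:
  fixes D :: "real measure"
  assumes "prob_space D" "sets D = sets borel" "AE x in D. x \<ge> 0"
    and int1: "integrable D (\<lambda>x. x)" and int2: "integrable D (\<lambda>x. x\<^sup>2)" and s: "s \<ge> 0"
  shows "integrable D (\<lambda>x. exp (- s * x))"
    and "(\<integral>x. exp (- s * x) \<partial>D) \<le> exp (- s * (\<integral>x. x \<partial>D) + s\<^sup>2 / 2 * (\<integral>x. x\<^sup>2 \<partial>D))"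
proof -
  interpret prob_space D by fact
  have meas: "(\<lambda>x. exp (- s * x)) \<in> borel_measurable D"
    by (subst measurable_cong_sets[OF assms(2) refl]) measurable
  show int: "integrable D (\<lambda>x. exp (- s * x))"
  proof (rule integrable_const_bound[where B = 1])
    show "AE x in D. norm (exp (- s * x)) \<le> 1"
      using assms(3) s by (auto elim!: eventually_mono)
  qed (rule meas)
  have intq: "integrable D (\<lambda>x. 1 - s * x + s\<^sup>2 / 2 * x\<^sup>2)"
    using int1 int2 by simp
  have "(\<integral>x. exp (- s * x) \<partial>D) \<le> (\<integral>x. 1 - s * x + s\<^sup>2 / 2 * x\<^sup>2 \<partial>D)"
  proof (rule integral_mono_AE[OF int intq])
    show "AE x in D. exp (- s * x) \<le> 1 - s * x + s\<^sup>2 / 2 * x\<^sup>2"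
      using assms(3)
    proof eventually_elim
      case (elim x)
      then show ?case
        using exp_minus_le_quadratic[of "s * x"] s by (simp add: power_mult_distrib)
    qed
  qed
  also have "\<dots> = 1 + (- s * (\<integral>x. x \<partial>D) + s\<^sup>2 / 2 * (\<integral>x. x\<^sup>2 \<partial>D))"
    using int1 int2 by (simp add: prob_space)
  also have "\<dots> \<le> exp (- s * (\<integral>x. x \<partial>D) + s\<^sup>2 / 2 * (\<integral>x. x\<^sup>2 \<partial>D))"
    by (rule exp_ge_add_one_self)
  finally show "(\<integral>x. exp (- s * x) \<partial>D) \<le> exp (- s * (\<integral>x. x \<partial>D) + s\<^sup>2 / 2 * (\<integral>x. x\<^sup>2 \<partial>D))" .
qed

lemma integral_PiM_prod:
  fixes f :: "'b \<Rightarrow> real"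
  assumes "prob_space D" "finite I" "J \<subseteq> I" "integrable D f"
  shows "integrable (\<Pi>\<^sub>M i\<in>I. D) (\<lambda>w. \<Prod>j\<in>J. f (w j))"
    and "(\<integral>w. (\<Prod>j\<in>J. f (w j)) \<partial>(\<Pi>\<^sub>M i\<in>I. D)) = (\<integral>x. f x \<partial>D) ^ card J"
proof -
  interpret D: prob_space D by fact
  interpret product_sigma_finite "\<lambda>_. D"
    by (simp add: product_sigma_finite_def D.sigma_finite_measure_axioms)
  \<comment> \<open>Extending the product over \<open>J\<close> by factors 1 makes it a product over the full index set.\<close>
  let ?g = "\<lambda>i x. if i \<in> J then f x else 1"
  have g: "integrable D (?g i)" for i
    using assms(4) by (cases "i \<in> J") simp_all
  have eq: "(\<Prod>j\<in>J. f (w j)) = (\<Prod>i\<in>I. ?g i (w i))" for w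
    using assms(2,3) by (intro prod.mono_neutral_cong_left) auto
  show "integrable (\<Pi>\<^sub>M i\<in>I. D) (\<lambda>w. \<Prod>j\<in>J. f (w j))"
    unfolding eq by (rule product_integrable_prod[OF assms(2) g])
  have "(\<integral>w. (\<Prod>j\<in>J. f (w j)) \<partial>(\<Pi>\<^sub>M i\<in>I. D)) = (\<Prod>i\<in>I. \<integral>x. ?g i x \<partial>D)"
    unfolding eq by (rule product_integral_prod[OF assms(2) g])
  also have "\<dots> = (\<Prod>i\<in>J. \<integral>x. f x \<partial>D)"
    using assms(2,3) by (intro prod.mono_neutral_cong_right) (auto simp: D.prob_space)
  finally show "(\<integral>w. (\<Prod>j\<in>J. f (w j)) \<partial>(\<Pi>\<^sub>M i\<in>I. D)) = (\<integral>x. f x \<partial>D) ^ card J"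
    by simp
qed

lemma sum_cyclic_sequences_le:
  fixes r :: real
  assumes r: "r \<ge> 0" and A: "finite A"
  shows "(\<Sum>vs\<in>cyclic_sequences n A. r ^ length vs) \<le> (\<Sum>k\<in>A. (real n * r) ^ k)"
proof -
  let ?S = "cyclic_sequences n A"
  have "(\<Sum>vs\<in>?S. r ^ length vs) = (\<Sum>k\<in>A. \<Sum>vs\<in>{vs \<in> ?S. length vs = k}. r ^ length vs)"
    by (rule sum.group[symmetric, OF finite_cyclic_sequences A])
      (auto simp: cyclic_sequences_def)
  also have "\<dots> = (\<Sum>k\<in>A. real (card {vs \<in> ?S. length vs = k}) * r ^ k)"
    by (intro sum.cong refl) simp
  also have "\<dots> \<le> (\<Sum>k\<in>A. real n ^ k * r ^ k)"
  proof (rule sum_mono)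
    fix k
    have "card {vs \<in> ?S. length vs = k} \<le> card {vs. set vs \<subseteq> {1..n} \<and> length vs = k}"
      by (intro card_mono finite_lists_length_eq) (auto simp: cyclic_sequences_def)
    also have "\<dots> = n ^ k"
      by (simp add: card_lists_length_eq)
    finally have "real (card {vs \<in> ?S. length vs = k}) \<le> real n ^ k"
      by (metis of_nat_le_iff of_nat_power)
    then show "real (card {vs \<in> ?S. length vs = k}) * r ^ k \<le> real n ^ k * r ^ k"
      using r by (intro mult_right_mono) auto
  qed
  finally show ?thesis
    by (simp add: power_mult_distrib)
qed

text \<open>The threshold \<open>t\<close> and the Chernoff parameter \<open>s\<close> are left free here; for \<open>t < E[W]\<close> a small
  \<open>s > 0\<close> makes the first exponent negative.\<close>

lemma grg_cycle_bound:
  fixes D :: "real measure"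
  defines "m1 \<equiv> \<integral>x. x \<partial>D" and "m2 \<equiv> \<integral>x. x\<^sup>2 \<partial>D"
  assumes D: "prob_space D" "sets D = sets borel" "AE x in D. x > 0"
    and int: "integrable D (\<lambda>x. x)" "integrable D (\<lambda>x. x\<^sup>2)"
    and n: "n \<ge> 1" and t: "t > 0" and s: "s \<ge> 0" and A: "finite A"
  shows "measure (grg n D) {G. cycle_count G A > 0}
       \<le> exp (real n * (s * t - s * m1 + s\<^sup>2 / 2 * m2)) + (\<Sum>k\<in>A. (m2 / t) ^ k)"
proof -
  let ?P = "\<Pi>\<^sub>M i\<in>{1..n}. D" and ?S = "cyclic_sequences n A"
  let ?X = "\<lambda>w. exp (s * (real n * t)) * (\<Prod>i\<in>{1..n}. exp (- s * w i))"
  let ?Y = "\<lambda>w. \<Sum>vs\<in>?S. (\<Prod>v\<in>set vs. (w v)\<^sup>2) / (real n * t) ^ length vs"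
  have nonneg: "AE x in D. x \<ge> 0"
    using D(3) by (auto elim!: eventually_mono)
  note laplace = laplace_transform_le[OF D(1,2) nonneg int s]
  have sub: "set vs \<subseteq> {1..n}" and card: "card (set vs) = length vs" if "vs \<in> ?S" for vs
    using that by (auto simp: cyclic_sequences_def distinct_card)
  note X = integral_PiM_prod[OF D(1) finite_atLeastAtMost subset_refl laplace(1), of 1 n]
  note Y = integral_PiM_prod[OF D(1) finite_atLeastAtMost sub int(2)]
  have intX: "integrable ?P ?X"
    using X(1) by (rule integrable_mult_right)
  have intY: "integrable ?P ?Y"
    using Y(1) by (intro Bochner_Integration.integrable_sum) auto
  have pos: "AE w in ?P. \<forall>i\<in>{1..n}. w i > 0"
    by (intro AE_finite_allI AE_PiM_component D) auto
  have "measure (grg n D) {G. cycle_count G A > 0}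
      = (\<integral>w. measure_pmf.prob (grg_given n w) {G. cycle_count G A > 0} \<partial>?P)"
    by (rule prob_grg[OF D(1,2)])
  also have "\<dots> \<le> (\<integral>w. ?X w + ?Y w \<partial>?P)"
  proof (rule integral_mono_AE')
    show "integrable ?P (\<lambda>w. ?X w + ?Y w)"
      using intX intY by simp
    show "AE w in ?P. measure_pmf.prob (grg_given n w) {G. cycle_count G A > 0} \<le> ?X w + ?Y w"
      using pos by eventually_elim (intro prob_cycle_count_le n t s, blast)
    show "AE w in ?P. 0 \<le> ?X w + ?Y w"
      using t by (intro AE_I2 add_nonneg_nonneg mult_nonneg_nonneg sum_nonneg
          divide_nonneg_nonneg prod_nonneg) auto
  qed
  also have "\<dots> = (\<integral>w. ?X w \<partial>?P) + (\<integral>w. ?Y w \<partial>?P)"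
    using intX intY by (rule Bochner_Integration.integral_add)
  also have "(\<integral>w. ?X w \<partial>?P) = exp (s * (real n * t)) * (\<integral>x. exp (- s * x) \<partial>D) ^ n"
    using X(2) by simp
  also have "\<dots> \<le> exp (s * (real n * t)) * exp (- s * m1 + s\<^sup>2 / 2 * m2) ^ n"
    unfolding m1_def m2_def
    by (intro mult_left_mono power_mono laplace Bochner_Integration.integral_nonneg) auto
  also have "\<dots> = exp (real n * (s * t - s * m1 + s\<^sup>2 / 2 * m2))"
    by (simp add: exp_of_nat_mult[symmetric] exp_add[symmetric] algebra_simps)
  also have "(\<integral>w. ?Y w \<partial>?P) = (\<Sum>vs\<in>?S. (m2 / (real n * t)) ^ length vs)"
    using Y by (simp add: Bochner_Integration.integral_sum card m2_def power_divide)
  also have "\<dots> \<le> (\<Sum>k\<in>A. (real n * (m2 / (real n * t))) ^ k)"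
    using t by (intro sum_cyclic_sequences_le A) (auto simp: m2_def)
  also have "real n * (m2 / (real n * t)) = m2 / t"
    using n by simp
  finally show ?thesis
    by simp
qed

section \<open>Powers of the number of vertices\<close>

lemma geometric_tail_le_powr:
  fixes p a :: real
  assumes p: "0 < p" "p < 1" and a: "a \<ge> 0" and n: "n \<ge> 1"
  shows "(\<Sum>k\<in>{nat \<lfloor>a * ln (real n)\<rfloor> + 1..n}. p ^ k) \<le> real n powr (a * ln p) / (1 - p)"
proof -
  let ?K = "nat \<lfloor>a * ln (real n)\<rfloor> + 1"
  have K: "a * ln (real n) \<le> real ?K"
  proof -
    have "0 \<le> a * ln (real n)"
      using n a by simp
    then have "real (nat \<lfloor>a * ln (real n)\<rfloor>) = of_int \<lfloor>a * ln (real n)\<rfloor>"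
      by (intro of_nat_nat) simp
    then show ?thesis
      using real_of_int_floor_add_one_ge[of "a * ln (real n)"]
      unfolding of_nat_add of_nat_1 by simp
  qed
  have "(\<Sum>k\<in>{?K..n}. p ^ k) \<le> p ^ ?K / (1 - p)"
    using p by (auto simp: sum_gp divide_right_mono)
  also have "p ^ ?K = p powr real ?K"
    using p by (intro powr_realpow[symmetric])
  also have "\<dots> \<le> p powr (a * ln (real n))"
    using K p by (intro powr_mono') auto
  also have "\<dots> = real n powr (a * ln p)"
    using p n by (simp add: powr_def mult_ac)
  finally show ?thesis
    using p by (simp add: divide_right_mono)
qed

text \<open>The product \<open>x powr b * exp (- c * x)\<close> is largest at \<open>x = b / c\<close>; comparing \<open>x\<close> with \<open>b / c\<close>
  therefore gives the right constant up to the factor \<open>exp b\<close>.\<close>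

lemma exp_minus_le_powr:
  fixes b c x :: real
  assumes "b > 0" "c > 0" "x > 0"
  shows "exp (- c * x) \<le> (b / c) powr b * x powr (- b)"
proof -
  have "0 < x / (b / c)"
    using assms by simp
  from ln_less_self[OF this] have "ln (x / (b / c)) \<le> x / (b / c)"
    by (rule less_imp_le)
  then have "b * (ln x - ln (b / c)) \<le> b * (x / (b / c))"
    using assms by (intro mult_left_mono) (simp_all only: ln_divide_pos divide_pos_pos less_imp_le)
  then have "- c * x \<le> b * ln (b / c) + - b * ln x"
    using assms by (simp add: right_diff_distrib mult.commute)
  then have "exp (- c * x) \<le> exp (b * ln (b / c) + - b * ln x)"
    by simp
  also have "\<dots> = (b / c) powr b * x powr (- b)"
    using assms by (simp add: powr_def exp_add[symmetric])
  finally show ?thesis .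
qed

section \<open>Long cycles are unlikely\<close>

theorem theorem2p3:
  fixes M :: "'a measure" and W :: "'a \<Rightarrow> real" and a p :: real
  assumes "prob_space M"
    and "W \<in> borel_measurable M"
    and "AE x in M. W x > 0"
    and "integrable M (\<lambda>x. (W x)\<^sup>2)"
    and "(\<integral>x. (W x)\<^sup>2 \<partial>M) < (\<integral>x. W x \<partial>M)"
    and "a > 0"
    and "p = 2 * (\<integral>x. (W x)\<^sup>2 \<partial>M) / ((\<integral>x. (W x)\<^sup>2 \<partial>M) + (\<integral>x. W x \<partial>M))"
  shows "\<exists>C>0. \<forall>n\<ge>3.
    measure (grg n (distr M borel W)) {G. cycle_count G {nat \<lfloor>a * ln (real n)\<rfloor> + 1..n} > 0}
      \<le> C * real n powr (a * ln p)"
proof -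
  interpret prob_space M by fact
  note [measurable] = assms(2)
  let ?D = "distr M borel W"
  define m1 where "m1 = (\<integral>x. W x \<partial>M)"
  define m2 where "m2 = (\<integral>x. (W x)\<^sup>2 \<partial>M)"
  have m2_nonneg: "m2 \<ge> 0"
    by (simp add: m2_def)
  have "m2 \<noteq> 0"
  proof
    assume "m2 = 0"
    then have "AE x in M. (W x)\<^sup>2 = 0"
      using assms(4) by (simp add: m2_def integral_nonneg_eq_0_iff_AE)
    with assms(3) have "AE x in M. False"
      by eventually_elim simp
    then show False
      by simp
  qed
  with m2_nonneg have m2: "m2 > 0"
    by simp
  have m12: "m2 < m1"
    using assms(5) by (simp add: m1_def m2_def)
  \<comment> \<open>The integral of a non-integrable function is 0, whereas the mean is positive.\<close>
  have intW: "integrable M W"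
    using m2 m12 not_integrable_integral_eq[of M W] by (fastforce simp: m1_def)
  define t where "t = (m1 + m2) / 2"
  \<comment> \<open>The Chernoff parameter minimising \<open>s * (t - m1) + s\<^sup>2 / 2 * m2\<close>, the minimum being \<open>- c\<close>.\<close>
  define s where "s = (m1 - t) / m2"
  define c where "c = (m1 - t)\<^sup>2 / (2 * m2)"
  have t: "t > 0" "t < m1"
    using m2 m12 by (auto simp: t_def)
  have c: "c > 0"
    using t m2 by (simp add: c_def)
  have s: "s \<ge> 0"
    using t m2 by (simp add: s_def)
  have expo: "s * t - s * m1 + s\<^sup>2 / 2 * m2 = - c"
    using m2 by (simp add: s_def c_def field_simps power2_eq_square)
  have p_eq: "p = m2 / t"
    using assms(7) by (simp add: m1_def m2_def t_def field_simps)
  have p: "0 < p" "p < 1"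
    using m2 m12 t by (auto simp: p_eq) (simp add: t_def)
  define b where "b = - (a * ln p)"
  have b: "b > 0"
    using assms(6) p by (simp add: b_def mult_pos_neg)
  define C where "C = (b / c) powr b + 1 / (1 - p)"
  have D: "prob_space ?D" "sets ?D = sets borel" "AE x in ?D. x > 0"
    using assms(3) by (auto intro!: prob_space_distr simp: AE_distr_iff)
  have int: "integrable ?D (\<lambda>x. x)" "integrable ?D (\<lambda>x. x\<^sup>2)"
    using intW assms(4) by (auto simp: integrable_distr_eq)
  have moments: "(\<integral>x. x \<partial>?D) = m1" "(\<integral>x. x\<^sup>2 \<partial>?D) = m2"
    by (simp_all add: integral_distr m1_def m2_def)
  have "measure (grg n ?D) {G. cycle_count G {nat \<lfloor>a * ln (real n)\<rfloor> + 1..n} > 0}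
      \<le> C * real n powr (a * ln p)" if n: "n \<ge> 3" for n
  proof -
    let ?A = "{nat \<lfloor>a * ln (real n)\<rfloor> + 1..n}"
    have "measure (grg n ?D) {G. cycle_count G ?A > 0} \<le> exp (- c * real n) + (\<Sum>k\<in>?A. p ^ k)"
      using grg_cycle_bound[OF D int _ t(1) s, of n ?A] n
      unfolding moments expo p_eq[symmetric] by (simp add: mult.commute)
    also have "exp (- c * real n) \<le> (b / c) powr b * real n powr (- b)"
      using n by (intro exp_minus_le_powr b c) auto
    also have "(\<Sum>k\<in>?A. p ^ k) \<le> real n powr (a * ln p) / (1 - p)"
      using n p assms(6) by (intro geometric_tail_le_powr) auto
    finally show ?thesis
      by (simp add: C_def b_def distrib_right)
  qed
  moreover have "C > 0"
    using b c p unfolding C_def by (intro add_nonneg_pos) auto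
  ultimately show ?thesis
    by blast
qed

end
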